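(* (i) Let $\{\varphi_j\}_{j\in\mathbb N}$ denote an enumeration of the countable set $\{\frac{\varphi}{\|\varphi\|_{\mathscr B^q}}:\varphi\in\mathscr D_0,\ \|\varphi\|_{\mathscr B^q}\ne0\}$. The vector space $\mathrm{Lin}(\mathscr D):=\{U:\mathscr D\to\mathbb R\text{ linear}\}$ endowed with the metric $$d(U,V;\mathrm{Lin}(\mathscr D)):=\sum_{j\in\mathbb N}2^{-j}\frac{|U(\varphi_j)-V(\varphi_j)|}{|U(\varphi_j)-V(\varphi_j)|+1}$$ is complete and separable. (ii) Let $\omega_0\in\Omega_0$. Consider the maps $$J_\varepsilon^{\omega_0}:L^p(Q)\to\mathrm{Lin}(\mathscr D),\qquad (J_\varepsilon^{\omega_0}u)(\varphi):=\int_Qu(x)(\mathcal T_\varepsilon^*\varphi)(\omega_0,x)\,dx,$$ $$J_0:\mathscr B^p\to\mathrm{Lin}(\mathscr D),\qquad (J_0u)(\varphi):=\Big\langle\int_Qu\varphi\,dx\Big\rangle.$$ Then for any bounded sequence $(u_\varepsilon)$ in $L^p(Q)$ and any $u\in\mathscr B^p$ we have $u_\varepsilon\stackrel2\rightharpoonup_{\omega_0}u$ if and only if $J_\varepsilon^{\omega_0}u_\varepsilon\to J_0u$ in $\mathrm{Lin}(\mathscr D)$.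
   Context: **Probability space.** $(\Omega,\mathcal F,P)$ is a complete and separable probability space and $\tau=\{\tau_x\}_{x\in\mathbb R^d}$ is a group of invertible measurable maps $\tau_x:\Omega\to\Omega$ with: (i) $\tau_0=\mathrm{Id}$, $\tau_{x+y}=\tau_x\circ\tau_y$; (ii) $P(\tau_{-x}E)=P(E)$ for all $E\in\mathcal F$, $x\in\mathbb R^d$; (iii) $(\omega,x)\mapsto\tau_x\omega$ is $(\mathcal F\otimes\mathcal L(\mathbb R^d),\mathcal F)$-measurable, $\mathcal L(\mathbb R^d)$ being the Lebesgue $\sigma$-algebra. $\langle\cdot\rangle:=\int_\Omega\cdot\,dP$. It is assumed that $\langle\cdot\rangle$ is ergodic: every $A\in\mathcal F$ with $\tau_xA=A$ for all $x\in\mathbb R^d$ satisfies $P(A)\in\{0,1\}$. **Exponents, domain, test functions.** $p\in(1,\infty)$, $q=\frac p{p-1}$, $Q\subset\mathbb R^d$ open and bounded, $\mathscr B^r:=L^r(\Omega\times Q)$ with its usual norm. $\mathscr D_\Omega$ is a fixed countable set of bounded $\mathcal F$-measurable functions on $\Omega$ containing the constant $\mathbf 1_\Omega\equiv1$ and dense in $L^1(\Omega)$ (hence in $L^r(\Omega)$, $1\le r<\infty$). $\mathscr D_Q\subset C(\overline Q)$ is a fixed countable set containing $\mathbf 1_Q\equiv1$ and dense in $L^1(Q)$ (hence in $L^r(Q)$, $1\le r<\infty$). $\mathscr A:=\{\varphi(\omega,x)=\varphi_\Omega(\omega)\varphi_Q(x):\varphi_\Omega\in\mathscr D_\Omega,\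 \varphi_Q\in\mathscr D_Q\}$, $\mathscr D_0$ is the $\mathbb Q$-linear span of $\mathscr A$ and $\mathscr D:=\operatorname{span}\mathscr A$. For $\varepsilon>0$, $(\mathcal T_\varepsilon^*\varphi)(\omega,x):=\varphi(\tau_{x/\varepsilon}\omega,x)$. $\Omega_0\subset\Omega$ is a fixed measurable set with $P(\Omega_0)=1$ such that for all $\varphi,\varphi'\in\mathscr A$, $\omega_0\in\Omega_0$, $r\in\{p,q\}$: $\limsup_{\varepsilon\to0}\|(\mathcal T^*_\varepsilon\varphi)(\omega_0,\cdot)\|_{L^r(Q)}\le\|\varphi\|_{\mathscr B^r}$ and $\lim_{\varepsilon\to0}\int_Q\mathcal T_\varepsilon^*(\varphi\varphi')(\omega_0,x)\,dx=\langle\int_Q\varphi\varphi'\,dx\rangle$. **Sequences.** Sequences are indexed by $\varepsilon>0$ with $\varepsilon\to0$. **Quenched two-scale convergence.** For $\omega_0\in\Omega_0$, a sequence $(u_\varepsilon)$ in $L^p(Q)$ and $u\in\mathscr B^p$, $u_\varepsilon\stackrel2\rightharpoonup_{\omega_0}u$ means that $(u_\varepsilon)$ is bounded in $L^p(Q)$ and $\lim_{\varepsilon\to0}\int_Qu_\varepsilon(x)(\mathcal T_\varepsilon^*\varphi)(\omega_0,x)\,dx=\int_\Omega\int_Qu\varphi\,dx\,dP$ for all $\varphi\in\mathscr D$. *)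

theory Defs
  imports "HOL-Probability.Probability"
begin

text \<open>The elements of \<open>L\<^sup>r\<close> are rendered by representatives; every notion below that takes an
  element of \<open>L\<^sup>r\<close> depends only on its almost-everywhere class. The exponents are finite.\<close>

definition Lspace :: "'a measure \<Rightarrow> real \<Rightarrow> ('a \<Rightarrow> real) set" where
  "Lspace N r = {f \<in> borel_measurable N. integrable N (\<lambda>x. \<bar>f x\<bar> powr r)}"

definition Lnorm :: "'a measure \<Rightarrow> real \<Rightarrow> ('a \<Rightarrow> real) \<Rightarrow> real" where
  "Lnorm N r f = (\<integral>x. \<bar>f x\<bar> powr r \<partial>N) powr (1 / r)"

definition dense_in_L1 :: "'a measure \<Rightarrow> ('a \<Rightarrow> real) set \<Rightarrow> bool" where
  "dense_in_L1 N D \<longleftrightarrow> D \<subseteq> Lspace N 1 \<and>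
     (\<forall>f \<in> Lspace N 1. \<forall>e > 0. \<exists>g \<in> D. Lnorm N 1 (\<lambda>x. f x - g x) < e)"

text \<open>The measure on \<open>\<Omega> \<times> Q\<close>, so that \<open>\<B>\<^sup>r\<close> is \<^term>\<open>Lspace (prodM M Q) r\<close>.\<close>

definition prodM :: "'w measure \<Rightarrow> (real^'n) set \<Rightarrow> ('w \<times> (real^'n)) measure" where
  "prodM M Q = M \<Otimes>\<^sub>M lebesgue_on Q"

text \<open>Separability means separability of the measure algebra, that is, of the events with
  respect to the pseudometric \<open>P (A \<triangle> B)\<close>.\<close>

locale ergodic_system = prob_space M + complete_measure M
  for M :: "'w measure" and \<tau> :: "real^'n \<Rightarrow> 'w \<Rightarrow> 'w" +
  assumes separable:
    "\<exists>\<C>. countable \<C> \<and> \<C> \<subseteq> sets M \<and>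
       (\<forall>A \<in> sets M. \<forall>e > 0. \<exists>C \<in> \<C>. measure M ((A - C) \<union> (C - A)) < e)"
  and tau_measurable: "\<And>x. \<tau> x \<in> M \<rightarrow>\<^sub>M M"
  and tau_invertible: "\<And>x. bij_betw (\<tau> x) (space M) (space M)"
  and tau_zero: "\<And>\<omega>. \<omega> \<in> space M \<Longrightarrow> \<tau> 0 \<omega> = \<omega>"
  and tau_add: "\<And>x y \<omega>. \<omega> \<in> space M \<Longrightarrow> \<tau> (x + y) \<omega> = \<tau> x (\<tau> y \<omega>)"
  and tau_preserves: "\<And>x E. E \<in> sets M \<Longrightarrow> measure M (\<tau> (- x) ` E) = measure M E"
  and tau_jointly_measurable: "(\<lambda>(\<omega>, x). \<tau> x \<omega>) \<in> (M \<Otimes>\<^sub>M lebesgue) \<rightarrow>\<^sub>M M"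
  and ergodic: "\<And>A. A \<in> sets M \<Longrightarrow> (\<forall>x. \<tau> x ` A = A) \<Longrightarrow> measure M A \<in> {0, 1}"

text \<open>Test functions are honest functions on \<open>\<Omega> \<times> Q\<close>, not almost-everywhere classes, since
  \<open>(\<T>\<^sub>\<epsilon>\<^sup>* \<phi>)(\<omega>\<^sub>0, \<cdot>)\<close> is evaluated at a fixed \<open>\<omega>\<^sub>0\<close>. They are extended by zero to the whole
  type, so that equality of functions on \<open>\<Omega> \<times> Q\<close> is HOL equality.\<close>

definition tensor ::
  "'w set \<Rightarrow> (real^'n) set \<Rightarrow> ('w \<Rightarrow> real) \<Rightarrow> (real^'n \<Rightarrow> real) \<Rightarrow> 'w \<times> (real^'n) \<Rightarrow> real" where
  "tensor W Q f g = (\<lambda>(\<omega>, x). if \<omega> \<in> W \<and> x \<in> Q then f \<omega> * g x else 0)"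

definition testA ::
  "'w set \<Rightarrow> (real^'n) set \<Rightarrow> ('w \<Rightarrow> real) set \<Rightarrow> (real^'n \<Rightarrow> real) set \<Rightarrow> ('w \<times> (real^'n) \<Rightarrow> real) set" where
  "testA W Q D\<Omega> DQ = {tensor W Q f g |f g. f \<in> D\<Omega> \<and> g \<in> DQ}"

definition span_over :: "real set \<Rightarrow> ('z \<Rightarrow> real) set \<Rightarrow> ('z \<Rightarrow> real) set" where
  "span_over K A = {\<lambda>z. \<Sum>a\<in>S. c a * a z |S c. finite S \<and> S \<subseteq> A \<and> (\<forall>a\<in>S. c a \<in> K)}"

definition testD0 ::
  "'w set \<Rightarrow> (real^'n) set \<Rightarrow> ('w \<Rightarrow> real) set \<Rightarrow> (real^'n \<Rightarrow> real) set \<Rightarrow> ('w \<times> (real^'n) \<Rightarrow> real) set" where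
  "testD0 W Q D\<Omega> DQ = span_over \<rat> (testA W Q D\<Omega> DQ)"

definition testD ::
  "'w set \<Rightarrow> (real^'n) set \<Rightarrow> ('w \<Rightarrow> real) set \<Rightarrow> (real^'n \<Rightarrow> real) set \<Rightarrow> ('w \<times> (real^'n) \<Rightarrow> real) set" where
  "testD W Q D\<Omega> DQ = span_over UNIV (testA W Q D\<Omega> DQ)"

definition unfolding_op ::
  "(real^'n \<Rightarrow> 'w \<Rightarrow> 'w) \<Rightarrow> real \<Rightarrow> ('w \<times> (real^'n) \<Rightarrow> real) \<Rightarrow> 'w \<Rightarrow> real^'n \<Rightarrow> real" where
  "unfolding_op \<tau> \<epsilon> \<phi> \<omega> x = \<phi> (\<tau> (x /\<^sub>R \<epsilon>) \<omega>, x)"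

locale two_scale_setting = ergodic_system M \<tau>
  for M :: "'w measure" and \<tau> :: "real^'n \<Rightarrow> 'w \<Rightarrow> 'w" +
  fixes p q :: real and Q :: "(real^'n) set"
    and D\<Omega> :: "('w \<Rightarrow> real) set" and DQ :: "(real^'n \<Rightarrow> real) set" and \<Omega>0 :: "'w set"
  assumes p_gt_1: "1 < p" and q_def: "q = p / (p - 1)"
  and Q_open: "open Q" and Q_bounded: "bounded Q"
  and DOmega_countable: "countable D\<Omega>"
  and DOmega_measurable: "D\<Omega> \<subseteq> borel_measurable M"
  and DOmega_bounded: "\<And>f. f \<in> D\<Omega> \<Longrightarrow> \<exists>B. \<forall>\<omega> \<in> space M. \<bar>f \<omega>\<bar> \<le> B"
  and DOmega_one: "(\<lambda>_. 1) \<in> D\<Omega>"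
  and DOmega_dense: "dense_in_L1 M D\<Omega>"
  and DQ_countable: "countable DQ"
  and DQ_continuous: "\<And>g. g \<in> DQ \<Longrightarrow> continuous_on (closure Q) g"
  and DQ_one: "(\<lambda>_. 1) \<in> DQ"
  and DQ_dense: "dense_in_L1 (lebesgue_on Q) DQ"
  and Omega0_sets: "\<Omega>0 \<in> sets M" and Omega0_full: "measure M \<Omega>0 = 1"
  and Omega0_norm: "\<And>\<phi> \<omega>0 r. \<phi> \<in> testA (space M) Q D\<Omega> DQ \<Longrightarrow> \<omega>0 \<in> \<Omega>0 \<Longrightarrow> r \<in> {p, q} \<Longrightarrow>
    Limsup (at_right 0) (\<lambda>\<epsilon>. ereal (Lnorm (lebesgue_on Q) r (unfolding_op \<tau> \<epsilon> \<phi> \<omega>0)))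
      \<le> ereal (Lnorm (prodM M Q) r \<phi>)"
  and Omega0_product: "\<And>\<phi> \<phi>' \<omega>0. \<phi> \<in> testA (space M) Q D\<Omega> DQ \<Longrightarrow>
    \<phi>' \<in> testA (space M) Q D\<Omega> DQ \<Longrightarrow> \<omega>0 \<in> \<Omega>0 \<Longrightarrow>
    ((\<lambda>\<epsilon>. \<integral>x. unfolding_op \<tau> \<epsilon> (\<lambda>z. \<phi> z * \<phi>' z) \<omega>0 x \<partial>lebesgue_on Q) \<longlongrightarrow>
      (\<integral>\<omega>. (\<integral>x. \<phi> (\<omega>, x) * \<phi>' (\<omega>, x) \<partial>lebesgue_on Q) \<partial>M)) (at_right 0)"

definition bounded_seq_Lp :: "(real^'n) set \<Rightarrow> real \<Rightarrow> (real \<Rightarrow> real^'n \<Rightarrow> real) \<Rightarrow> bool" where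
  "bounded_seq_Lp Q p u \<longleftrightarrow> (\<forall>\<epsilon> > 0. u \<epsilon> \<in> Lspace (lebesgue_on Q) p) \<and>
     (\<exists>C. \<forall>\<epsilon> > 0. Lnorm (lebesgue_on Q) p (u \<epsilon>) \<le> C)"

definition quenched_two_scale ::
  "'w measure \<Rightarrow> (real^'n \<Rightarrow> 'w \<Rightarrow> 'w) \<Rightarrow> (real^'n) set \<Rightarrow> real \<Rightarrow> ('w \<times> (real^'n) \<Rightarrow> real) set \<Rightarrow> 'w \<Rightarrow>
   (real \<Rightarrow> real^'n \<Rightarrow> real) \<Rightarrow> ('w \<times> (real^'n) \<Rightarrow> real) \<Rightarrow> bool" where
  "quenched_two_scale M \<tau> Q p D \<omega>0 u u0 \<longleftrightarrow> bounded_seq_Lp Q p u \<and>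
     (\<forall>\<phi> \<in> D. ((\<lambda>\<epsilon>. \<integral>x. u \<epsilon> x * unfolding_op \<tau> \<epsilon> \<phi> \<omega>0 x \<partial>lebesgue_on Q) \<longlongrightarrow>
       (\<integral>\<omega>. (\<integral>x. u0 (\<omega>, x) * \<phi> (\<omega>, x) \<partial>lebesgue_on Q) \<partial>M)) (at_right 0))"

text \<open>Functionals on \<open>D\<close> are extensional, so that equality on \<open>D\<close> is HOL equality. No continuity
  is required.\<close>

definition Lin :: "('z \<Rightarrow> real) set \<Rightarrow> (('z \<Rightarrow> real) \<Rightarrow> real) set" where
  "Lin D = {U \<in> extensional D.
     (\<forall>\<phi>\<in>D. \<forall>\<psi>\<in>D. U (\<lambda>z. \<phi> z + \<psi> z) = U \<phi> + U \<psi>) \<and>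
     (\<forall>c. \<forall>\<phi>\<in>D. U (\<lambda>z. c * \<phi> z) = c * U \<phi>)}"

definition dLin :: "(nat \<Rightarrow> 'z \<Rightarrow> real) \<Rightarrow> (('z \<Rightarrow> real) \<Rightarrow> real) \<Rightarrow> (('z \<Rightarrow> real) \<Rightarrow> real) \<Rightarrow> real" where
  "dLin \<Phi> U V = (\<Sum>j. (1/2) ^ j * (\<bar>U (\<Phi> j) - V (\<Phi> j)\<bar> / (\<bar>U (\<Phi> j) - V (\<Phi> j)\<bar> + 1)))"

definition J_eps ::
  "(real^'n \<Rightarrow> 'w \<Rightarrow> 'w) \<Rightarrow> (real^'n) set \<Rightarrow> ('w \<times> (real^'n) \<Rightarrow> real) set \<Rightarrow> real \<Rightarrow> 'w \<Rightarrow>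
   (real^'n \<Rightarrow> real) \<Rightarrow> (('w \<times> (real^'n) \<Rightarrow> real) \<Rightarrow> real)" where
  "J_eps \<tau> Q D \<epsilon> \<omega>0 u = (\<lambda>\<phi>\<in>D. \<integral>x. u x * unfolding_op \<tau> \<epsilon> \<phi> \<omega>0 x \<partial>lebesgue_on Q)"

definition J_zero ::
  "'w measure \<Rightarrow> (real^'n) set \<Rightarrow> ('w \<times> (real^'n) \<Rightarrow> real) set \<Rightarrow>
   ('w \<times> (real^'n) \<Rightarrow> real) \<Rightarrow> (('w \<times> (real^'n) \<Rightarrow> real) \<Rightarrow> real)" where
  "J_zero M Q D u = (\<lambda>\<phi>\<in>D. \<integral>\<omega>. (\<integral>x. u (\<omega>, x) * \<phi> (\<omega>, x) \<partial>lebesgue_on Q) \<partial>M)"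

end

theory Submission
  imports Defs
begin

text \<open>Every test function is a finite linear combination of the \<open>\<Phi> j\<close>, so a linear functional on
  \<open>\<D>\<close> is determined by its values on them, and pointwise convergence on the \<open>\<Phi> j\<close> is pointwise
  convergence on \<open>\<D>\<close>. The metric \<^const>\<open>dLin\<close> metrizes the former by dominated convergence of its
  series (Tannery). A pointwise limit of linear functionals is linear, which gives completeness;
  separability follows because \<^term>\<open>Lin D\<close> is a subspace of a countable product of lines. Part (ii)
  only remains to check that \<^const>\<open>J_eps\<close> and \<^const>\<open>J_zero\<close> take values in \<^term>\<open>Lin D\<close>, i.e. that
  test functions are bounded and measurable.\<close>

section \<open>Linear spans of families of functions\<close>

lemma span_over_zero: "(\<lambda>z. 0) \<in> span_over K A"
  unfolding span_over_def by (auto intro!: exI[of _ "{}"])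

lemma span_over_base:
  assumes "1 \<in> K" "a \<in> A"
  shows "a \<in> span_over K A"
  unfolding span_over_def using assms by (auto intro!: exI[of _ "{a}"] exI[of _ "\<lambda>_. 1"])

lemma span_over_mono: "K \<subseteq> L \<Longrightarrow> span_over K A \<subseteq> span_over L A"
  unfolding span_over_def by blast

lemma span_over_add:
  assumes K: "0 \<in> K" "\<And>x y. x \<in> K \<Longrightarrow> y \<in> K \<Longrightarrow> x + y \<in> K"
    and "\<phi> \<in> span_over K A" "\<psi> \<in> span_over K A"
  shows "(\<lambda>z. \<phi> z + \<psi> z) \<in> span_over K A"
proof -
  obtain S c where S: "finite S" "S \<subseteq> A" "\<forall>a\<in>S. c a \<in> K" "\<phi> = (\<lambda>z. \<Sum>a\<in>S. c a * a z)"
    using assms(3) unfolding span_over_def by blast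
  obtain T d where T: "finite T" "T \<subseteq> A" "\<forall>a\<in>T. d a \<in> K" "\<psi> = (\<lambda>z. \<Sum>a\<in>T. d a * a z)"
    using assms(4) unfolding span_over_def by blast
  \<comment> \<open>\<open>span_over\<close> records one coefficient per generator, so both families
    are extended by 0 to the union of the supports and then added.\<close>
  define e where "e a = (if a \<in> S then c a else 0) + (if a \<in> T then d a else 0)" for a
  have "(\<Sum>a\<in>S. c a * a z) + (\<Sum>a\<in>T. d a * a z) = (\<Sum>a\<in>S \<union> T. e a * a z)" for z
  proof -
    have "(\<Sum>a\<in>S. c a * a z) = (\<Sum>a\<in>S \<union> T. (if a \<in> S then c a else 0) * a z)"
      using S(1) T(1) by (intro sum.mono_neutral_cong_left) auto
    moreover have "(\<Sum>a\<in>T. d a * a z) = (\<Sum>a\<in>S \<union> T. (if a \<in> T then d a else 0) * a z)"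
      using S(1) T(1) by (intro sum.mono_neutral_cong_left) auto
    ultimately show ?thesis
      by (simp add: e_def distrib_right sum.distrib)
  qed
  moreover have "\<forall>a\<in>S \<union> T. e a \<in> K"
    using S(3) T(3) K by (auto simp: e_def)
  ultimately show ?thesis
    unfolding span_over_def using S T
    by (intro CollectI exI[of _ "S \<union> T"] exI[of _ e]) auto
qed

lemma span_over_scale:
  assumes "\<And>x. x \<in> K \<Longrightarrow> r * x \<in> K" "\<phi> \<in> span_over K A"
  shows "(\<lambda>z. r * \<phi> z) \<in> span_over K A"
proof -
  obtain S c where S: "finite S" "S \<subseteq> A" "\<forall>a\<in>S. c a \<in> K" "\<phi> = (\<lambda>z. \<Sum>a\<in>S. c a * a z)"
    using assms(2) unfolding span_over_def by blast
  then show ?thesis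
    unfolding span_over_def using assms(1)
    by (intro CollectI exI[of _ S] exI[of _ "\<lambda>a. r * c a"])
       (auto simp: sum_distrib_left mult.assoc)
qed

lemma span_over_sum:
  assumes "finite S" "\<And>a. a \<in> S \<Longrightarrow> f a \<in> span_over UNIV A"
  shows "(\<lambda>z. \<Sum>a\<in>S. c a * f a z) \<in> span_over UNIV A"
  using assms by induction (simp_all add: span_over_zero span_over_add span_over_scale)

lemma span_over_minimal:
  assumes "A \<subseteq> span_over UNIV B"
  shows "span_over UNIV A \<subseteq> span_over UNIV B"
proof
  fix \<phi> assume "\<phi> \<in> span_over UNIV A"
  then obtain S c where "finite S" "S \<subseteq> A" "\<phi> = (\<lambda>z. \<Sum>a\<in>S. c a * a z)"
    unfolding span_over_def by blast
  then show "\<phi> \<in> span_over UNIV B"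
    using span_over_sum[of S "\<lambda>a. a" B c] assms by auto
qed

section \<open>Linear functionals on a span and their values on generators\<close>

lemma Lin_lincomb:
  assumes "U \<in> Lin D" "D = span_over UNIV A" "finite S" "S \<subseteq> A"
  shows "U (\<lambda>z. \<Sum>a\<in>S. c a * a z) = (\<Sum>a\<in>S. c a * U a)"
  using assms(3,4)
proof induction
  case empty
  \<comment> \<open>The empty sum is the zero function; homogeneity with factor 0 gives it the value
    0.\<close>
  have "\<forall>c. \<forall>\<phi>\<in>D. U (\<lambda>z. c * \<phi> z) = c * U \<phi>" "(\<lambda>z. 0) \<in> D"
    using assms(1,2) by (simp_all add: Lin_def span_over_zero)
  from bspec[OF spec[OF this(1), of 0] this(2)] show ?case by simp
next
  case (insert a S)
  have a: "a \<in> D"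
    using insert.prems assms(2) span_over_base[of UNIV a A] by simp
  have "(\<lambda>z. c a * a z) \<in> D"
    using a assms(2) span_over_scale[of UNIV "c a" a A] by simp
  moreover have "(\<lambda>z. \<Sum>a\<in>S. c a * a z) \<in> D"
    using insert.hyps(1) insert.prems assms(2) span_over_base[of UNIV _ A]
      span_over_sum[of S "\<lambda>a. a" A c] by auto
  ultimately have "U (\<lambda>z. c a * a z + (\<Sum>a\<in>S. c a * a z)) = c a * U a + U (\<lambda>z. \<Sum>a\<in>S. c a * a z)"
    using assms(1) a unfolding Lin_def by simp
  then show ?case using insert by simp
qed

text \<open>Here \<open>l\<close> is any family of limits on the generators, not a linear
  functional, so the lemma is available in the completeness proof before a limit functional exists.
  Membership in \<open>Lin D\<close> is asked only eventually because along
  \<open>at_right 0\<close> it is known only for positive \<open>\<epsilon>\<close>.\<close>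

lemma Lin_tendsto_lincomb:
  assumes "eventually (\<lambda>x. u x \<in> Lin D) F" "D = span_over UNIV A" "finite S" "S \<subseteq> A"
    and "\<And>a. a \<in> S \<Longrightarrow> ((\<lambda>x. u x a) \<longlongrightarrow> l a) F"
  shows "((\<lambda>x. u x (\<lambda>z. \<Sum>a\<in>S. c a * a z)) \<longlongrightarrow> (\<Sum>a\<in>S. c a * l a)) F"
proof (rule Lim_transform_eventually)
  show "((\<lambda>x. \<Sum>a\<in>S. c a * u x a) \<longlongrightarrow> (\<Sum>a\<in>S. c a * l a)) F"
    by (intro tendsto_intros assms(5))
  show "eventually (\<lambda>x. (\<Sum>a\<in>S. c a * u x a) = u x (\<lambda>z. \<Sum>a\<in>S. c a * a z)) F"
    using assms(1) by eventually_elim (simp add: Lin_lincomb[OF _ assms(2-4)])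
qed

text \<open>Both functionals expand over the generators, and extensionality forces agreement off
  \<open>D\<close> as well. This yields definiteness of the metric.\<close>

lemma Lin_eqI:
  assumes "U \<in> Lin D" "V \<in> Lin D" "D = span_over UNIV A" "\<And>a. a \<in> A \<Longrightarrow> U a = V a"
  shows "U = V"
proof (rule extensionalityI[of U D])
  fix \<phi> assume "\<phi> \<in> D"
  then obtain S c where S: "finite S" "S \<subseteq> A" "\<phi> = (\<lambda>z. \<Sum>a\<in>S. c a * a z)"
    using assms(3) unfolding span_over_def by blast
  have "(\<Sum>a\<in>S. c a * U a) = (\<Sum>a\<in>S. c a * V a)"
    using S(2) assms(4) by (intro sum.cong) auto
  then show "U \<phi> = V \<phi>"
    using S Lin_lincomb[OF assms(1,3)] Lin_lincomb[OF assms(2,3)] by simp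
qed (use assms in \<open>auto simp: Lin_def\<close>)

lemma Lin_combination:
  assumes D: "D = span_over UNIV A" and "U \<in> Lin D" "V \<in> Lin D"
  shows "(\<lambda>\<phi>\<in>D. a * U \<phi> + b * V \<phi>) \<in> Lin D"
  using assms(2,3) span_over_add[of UNIV _ A] span_over_scale[of UNIV _ _ A]
  unfolding Lin_def D by (auto simp: algebra_simps)

section \<open>The bounded distance t/(1+t) and the weighted series \<open>dLin\<close> built from
  it\<close>

definition truncate :: "real \<Rightarrow> real" where
  "truncate t = \<bar>t\<bar> / (\<bar>t\<bar> + 1)"

lemma truncate_nonneg: "0 \<le> truncate t" and truncate_le_1: "truncate t \<le> 1"
  and truncate_minus: "truncate (s - t) = truncate (t - s)"
  by (auto simp: truncate_def divide_simps abs_minus_commute)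

lemma truncate_mono: "\<bar>s\<bar> \<le> \<bar>t\<bar> \<Longrightarrow> truncate s \<le> truncate t"
  by (simp add: truncate_def field_simps)

lemma truncate_triangle: "truncate (s + t) \<le> truncate s + truncate t"
proof -
  have "truncate (s + t) \<le> truncate (\<bar>s\<bar> + \<bar>t\<bar>)"
    by (rule truncate_mono) auto
  also have "\<dots> = \<bar>s\<bar> / (\<bar>s\<bar> + \<bar>t\<bar> + 1) + \<bar>t\<bar> / (\<bar>s\<bar> + \<bar>t\<bar> + 1)"
    by (simp add: truncate_def add_divide_distrib)
  \<comment> \<open>Each fraction grows when the other absolute value is dropped from its
    denominator.\<close>
  also have "\<dots> \<le> truncate s + truncate t"
    unfolding truncate_def by (intro add_mono divide_left_mono) auto
  finally show ?thesis .
qed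

text \<open>Contraposition of monotonicity; it turns a small truncated distance back into a small
  distance.\<close>

lemma abs_less_if_truncate_less:
  assumes "e > 0" "truncate t < truncate e"
  shows "\<bar>t\<bar> < e"
  using truncate_mono[of e t] assms by force

lemma dLin_altdef: "dLin \<Phi> U V = (\<Sum>j. (1/2) ^ j * truncate (U (\<Phi> j) - V (\<Phi> j)))"
  by (simp add: dLin_def truncate_def)

text \<open>The geometric majorant does not depend on \<open>t\<close>: it gives summability and
  also serves as the dominating sequence in Tannery's theorem.\<close>

lemma dLin_term_bound: "norm ((1/2) ^ j * truncate t) \<le> (1/2) ^ j"
  by (simp add: abs_mult truncate_nonneg truncate_le_1)

lemma summable_dLin: "summable (\<lambda>j. (1/2) ^ j * truncate (w j))"
  by (rule summable_comparison_test'[OF summable_geometric[of "1/2"] dLin_term_bound]) simp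

lemma dLin_term_le: "(1/2) ^ j * truncate (U (\<Phi> j) - V (\<Phi> j)) \<le> dLin \<Phi> U V"
  using sum_le_suminf[OF summable_dLin, of "{j}" "\<lambda>j. U (\<Phi> j) - V (\<Phi> j)"]
  by (simp add: dLin_altdef truncate_nonneg)

lemma dLin_nonneg: "0 \<le> dLin \<Phi> U V"
  by (simp add: dLin_altdef suminf_nonneg[OF summable_dLin] truncate_nonneg)

text \<open>A single nonnegative term is at most the whole series, and the weight cancels. The
  threshold depends on \<open>j\<close>, so the control is coordinatewise and not uniform.\<close>

lemma abs_less_if_dLin_less:
  assumes "e > 0" "dLin \<Phi> U V < (1/2) ^ j * truncate e"
  shows "\<bar>U (\<Phi> j) - V (\<Phi> j)\<bar> < e"
proof (rule abs_less_if_truncate_less[OF assms(1)])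
  have "(1/2) ^ j * truncate (U (\<Phi> j) - V (\<Phi> j)) < (1/2) ^ j * truncate e"
    using dLin_term_le assms(2) by (rule le_less_trans)
  then show "truncate (U (\<Phi> j) - V (\<Phi> j)) < truncate e" by simp
qed

lemma dLin_tendsto_0_iff:
  "((\<lambda>x. dLin \<Phi> (u x) v) \<longlongrightarrow> 0) F \<longleftrightarrow> (\<forall>j. ((\<lambda>x. u x (\<Phi> j)) \<longlongrightarrow> v (\<Phi> j)) F)"
  (is "?L \<longleftrightarrow> ?R")
proof
  assume L: ?L
  show ?R
  proof (intro allI tendstoI)
    fix j and e :: real assume e: "e > 0"
    then have "0 < (1/2) ^ j * truncate e" by (simp add: truncate_def)
    then have "eventually (\<lambda>x. dLin \<Phi> (u x) v < (1/2) ^ j * truncate e) F"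
      using order_tendstoD(2)[OF L] by blast
    then show "eventually (\<lambda>x. dist (u x (\<Phi> j)) (v (\<Phi> j)) < e) F"
      by eventually_elim (simp add: dist_real_def abs_less_if_dLin_less[OF e])
  qed
next
  assume R: ?R
  show ?L
  \<comment> \<open>Tannery's theorem is applied on a nontrivial filter; along \<open>bot\<close>
    every limit holds.\<close>
  proof (cases "F = bot")
    case False
    have "((\<lambda>x. \<Sum>j. (1/2) ^ j * truncate (u x (\<Phi> j) - v (\<Phi> j))) \<longlongrightarrow> (\<Sum>j. 0)) F"
    proof (rule tannerys_theorem[where M = "\<lambda>j. (1/2) ^ j", THEN conjunct2, THEN conjunct2])
      fix j
      have "((\<lambda>x. (1/2) ^ j * truncate (u x (\<Phi> j) - v (\<Phi> j))) \<longlongrightarrow>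
          (1/2) ^ j * truncate (v (\<Phi> j) - v (\<Phi> j))) F"
        unfolding truncate_def using R by (intro tendsto_intros) auto
      then show "((\<lambda>x. (1/2) ^ j * truncate (u x (\<Phi> j) - v (\<Phi> j))) \<longlongrightarrow> 0) F"
        by (simp add: truncate_def)
    qed (use False dLin_term_bound in \<open>auto intro!: always_eventually simp del: real_norm_def\<close>)
    then show ?thesis by (simp add: dLin_altdef)
  qed simp
qed

section \<open>Metric axioms, convergence, completeness and separability of
  \<open>Lin D\<close>\<close>

lemma Metric_space_Lin:
  assumes D: "D = span_over UNIV (range \<Phi>)"
  shows "Metric_space (Lin D) (dLin \<Phi>)"
proof
  fix U V W
  show "0 \<le> dLin \<Phi> U V" by (rule dLin_nonneg)
  show "dLin \<Phi> U V = dLin \<Phi> V U" by (simp add: dLin_altdef truncate_minus)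
  show "dLin \<Phi> U V = 0 \<longleftrightarrow> U = V" if "U \<in> Lin D" "V \<in> Lin D"
  proof
    assume "dLin \<Phi> U V = 0"
    \<comment> \<open>Distance 0 is read as convergence of the constant sequence \<open>U\<close> to
      \<open>V\<close>; uniqueness of real limits then gives equality at every
      \<open>\<Phi> j\<close>.\<close>
    then have "\<forall>j. ((\<lambda>x::nat. U (\<Phi> j)) \<longlongrightarrow> V (\<Phi> j)) sequentially"
      using dLin_tendsto_0_iff[of \<Phi> "\<lambda>_. U" V sequentially] by simp
    then show "U = V"
      by (intro Lin_eqI[OF that D]) (auto simp: LIMSEQ_const_iff)
  qed (simp add: dLin_def)
  have "dLin \<Phi> U W \<le> (\<Sum>j. (1/2) ^ j * truncate (U (\<Phi> j) - V (\<Phi> j))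
      + (1/2) ^ j * truncate (V (\<Phi> j) - W (\<Phi> j)))"
    unfolding dLin_altdef
  proof (rule suminf_le)
    fix j
    have "(1/2) ^ j * truncate (U (\<Phi> j) - W (\<Phi> j)) \<le> (1/2) ^ j *
      (truncate (U (\<Phi> j) - V (\<Phi> j)) + truncate (V (\<Phi> j) - W (\<Phi> j)))"
      using truncate_triangle[of "U (\<Phi> j) - V (\<Phi> j)" "V (\<Phi> j) - W (\<Phi> j)"] by simp
    then show "(1/2) ^ j * truncate (U (\<Phi> j) - W (\<Phi> j)) \<le>
      (1/2) ^ j * truncate (U (\<Phi> j) - V (\<Phi> j)) + (1/2) ^ j * truncate (V (\<Phi> j) - W (\<Phi> j))"
      by (simp add: distrib_left)
  qed (intro summable_add summable_dLin)+
  also have "\<dots> = dLin \<Phi> U V + dLin \<Phi> V W"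
    unfolding dLin_altdef by (intro suminf_add[symmetric] summable_dLin)
  finally show "dLin \<Phi> U W \<le> dLin \<Phi> U V + dLin \<Phi> V W" .
qed

text \<open>Linear combinations carry convergence from the \<open>\<Phi> j\<close> to all of
  \<open>D\<close>. The filter is arbitrary so that the same fact serves sequences in the
  completeness proof and the limit \<open>\<epsilon> \<rightarrow> 0\<close> in part (ii).\<close>

lemma limitin_Lin_iff:
  assumes D: "D = span_over UNIV (range \<Phi>)" and "v \<in> Lin D" "eventually (\<lambda>x. u x \<in> Lin D) F"
  shows "limitin (Metric_space.mtopology (Lin D) (dLin \<Phi>)) u v F \<longleftrightarrow>
    (\<forall>\<phi>\<in>D. ((\<lambda>x. u x \<phi>) \<longlongrightarrow> v \<phi>) F)"
proof -
  interpret Metric_space "Lin D" "dLin \<Phi>" using D by (rule Metric_space_Lin)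
  have "limitin mtopology u v F \<longleftrightarrow> ((\<lambda>x. dLin \<Phi> (u x) v) \<longlongrightarrow> 0) F"
    using assms(2,3) by (auto simp: limitin_metric tendsto_iff dLin_nonneg eventually_conj_iff)
  also have "\<dots> \<longleftrightarrow> (\<forall>j. ((\<lambda>x. u x (\<Phi> j)) \<longlongrightarrow> v (\<Phi> j)) F)"
    by (rule dLin_tendsto_0_iff)
  also have "\<dots> \<longleftrightarrow> (\<forall>\<phi>\<in>D. ((\<lambda>x. u x \<phi>) \<longlongrightarrow> v \<phi>) F)"
  proof safe
    fix \<phi> assume lim: "\<forall>j. ((\<lambda>x. u x (\<Phi> j)) \<longlongrightarrow> v (\<Phi> j)) F" and "\<phi> \<in> D"
    obtain S c where S: "finite S" "S \<subseteq> range \<Phi>" "\<phi> = (\<lambda>z. \<Sum>a\<in>S. c a * a z)"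
      using D \<open>\<phi> \<in> D\<close> unfolding span_over_def by blast
    have "((\<lambda>x. u x \<phi>) \<longlongrightarrow> (\<Sum>a\<in>S. c a * v a)) F"
      unfolding S(3) using S(2) lim by (intro Lin_tendsto_lincomb[OF assms(3) D S(1,2)]) auto
    then show "((\<lambda>x. u x \<phi>) \<longlongrightarrow> v \<phi>) F"
      by (simp add: S(3) Lin_lincomb[OF assms(2) D S(1,2)])
  next
    fix j assume "\<forall>\<phi>\<in>D. ((\<lambda>x. u x \<phi>) \<longlongrightarrow> v \<phi>) F"
    then show "((\<lambda>x. u x (\<Phi> j)) \<longlongrightarrow> v (\<Phi> j)) F"
      using D span_over_base[of UNIV "\<Phi> j" "range \<Phi>"] by simp
  qed
  finally show ?thesis .
qed

lemma mcomplete_Lin: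
  assumes D: "D = span_over UNIV (range \<Phi>)"
  shows "Metric_space.mcomplete (Lin D) (dLin \<Phi>)"
proof -
  interpret Metric_space "Lin D" "dLin \<Phi>" using D by (rule Metric_space_Lin)
  show ?thesis
    unfolding mcomplete_def
  proof (intro allI impI)
    fix \<sigma> assume \<sigma>: "MCauchy \<sigma>"
    then have Lin: "\<sigma> n \<in> Lin D" for n by (auto simp: MCauchy_def)
    have "\<exists>l. (\<lambda>n. \<sigma> n (\<Phi> j)) \<longlonglongrightarrow> l" for j
    proof -
      have "Cauchy (\<lambda>n. \<sigma> n (\<Phi> j))"
      proof (rule metric_CauchyI)
        fix e :: real assume e: "e > 0"
        then have "0 < (1/2) ^ j * truncate e" by (simp add: truncate_def)
        then obtain N where "\<And>m n. m \<ge> N \<Longrightarrow> n \<ge> N \<Longrightarrow>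
            dLin \<Phi> (\<sigma> m) (\<sigma> n) < (1/2) ^ j * truncate e"
          using \<sigma> unfolding MCauchy_def by metis
        then show "\<exists>N. \<forall>m\<ge>N. \<forall>n\<ge>N. dist (\<sigma> m (\<Phi> j)) (\<sigma> n (\<Phi> j)) < e"
          using abs_less_if_dLin_less[OF e] unfolding dist_real_def by blast
      qed
      then show ?thesis
        by (simp add: Cauchy_convergent_iff convergent_def)
    qed
    \<comment> \<open>Limits are indexed by the function \<open>a\<close> instead of the index
      \<open>j\<close>, since an enumeration may repeat values and the expansions run over sets of
      functions.\<close>
    then have "\<forall>a\<in>range \<Phi>. \<exists>l. (\<lambda>n. \<sigma> n a) \<longlonglongrightarrow> l" by simp
    then obtain m where m: "\<And>a. a \<in> range \<Phi> \<Longrightarrow> (\<lambda>n. \<sigma> n a) \<longlonglongrightarrow> m a"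
      using bchoice[of "range \<Phi>" "\<lambda>a l. (\<lambda>n. \<sigma> n a) \<longlonglongrightarrow> l"] by blast
    have "\<exists>l. (\<lambda>n. \<sigma> n \<phi>) \<longlonglongrightarrow> l" if \<phi>: "\<phi> \<in> D" for \<phi>
    proof -
      obtain S c where S: "finite S" "S \<subseteq> range \<Phi>" "\<phi> = (\<lambda>z. \<Sum>a\<in>S. c a * a z)"
        using D \<phi> unfolding span_over_def by blast
      have "(\<lambda>n. \<sigma> n \<phi>) \<longlonglongrightarrow> (\<Sum>a\<in>S. c a * m a)"
        unfolding S(3) using S(2) m Lin by (intro Lin_tendsto_lincomb[OF _ D S(1,2)]) auto
      then show ?thesis ..
    qed
    then obtain l where l: "\<And>\<phi>. \<phi> \<in> D \<Longrightarrow> (\<lambda>n. \<sigma> n \<phi>) \<longlonglongrightarrow> l \<phi>" by metis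
    \<comment> \<open>The restriction makes the pointwise limit extensional, as membership in
      \<open>Lin D\<close> demands.\<close>
    define V where "V = restrict l D"
    have V: "(\<lambda>n. \<sigma> n \<phi>) \<longlonglongrightarrow> V \<phi>" if "\<phi> \<in> D" for \<phi>
      using l that by (simp add: V_def)
    have "V \<in> Lin D"
      unfolding Lin_def
    proof (intro CollectI conjI ballI allI)
      show "V \<in> extensional D" by (simp add: V_def)
      fix \<phi> c assume \<phi>: "\<phi> \<in> D"
      have "(\<lambda>z. c * \<phi> z) \<in> D" using \<phi> D span_over_scale[of UNIV c \<phi>] by simp
      moreover have "\<sigma> n (\<lambda>z. c * \<phi> z) = c * \<sigma> n \<phi>" for n
        using Lin[of n] \<phi> by (simp add: Lin_def)
      ultimately show "V (\<lambda>z. c * \<phi> z) = c * V \<phi>"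
        using V[of "\<lambda>z. c * \<phi> z"] tendsto_mult[OF tendsto_const V[OF \<phi>], of c]
        by (auto intro: LIMSEQ_unique)
      fix \<psi> assume \<psi>: "\<psi> \<in> D"
      have "(\<lambda>z. \<phi> z + \<psi> z) \<in> D" using \<phi> \<psi> D span_over_add[of UNIV \<phi> _ \<psi>] by simp
      moreover have "\<sigma> n (\<lambda>z. \<phi> z + \<psi> z) = \<sigma> n \<phi> + \<sigma> n \<psi>" for n
        using Lin[of n] \<phi> \<psi> by (simp add: Lin_def)
      ultimately show "V (\<lambda>z. \<phi> z + \<psi> z) = V \<phi> + V \<psi>"
        using V[of "\<lambda>z. \<phi> z + \<psi> z"] tendsto_add[OF V[OF \<phi>] V[OF \<psi>]]
        by (auto intro: LIMSEQ_unique)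
    qed
    then have "limitin mtopology \<sigma> V sequentially"
      using V Lin by (simp add: limitin_Lin_iff[OF D])
    then show "\<exists>V. limitin mtopology \<sigma> V sequentially" by blast
  qed
qed

lemma separable_Lin:
  assumes D: "D = span_over UNIV (range \<Phi>)"
  shows "separable_space (Metric_space.mtopology (Lin D) (dLin \<Phi>))"
proof -
  interpret Metric_space "Lin D" "dLin \<Phi>" using D by (rule Metric_space_Lin)
  \<comment> \<open>Linear relations among the \<open>\<Phi> j\<close> may prevent a rational vector
    from being the values of any functional. Hence each pair \<open>(k, r)\<close> selects an actual
    functional near \<open>r\<close> in the first \<open>k\<close> coordinates whenever one exists.
    Lists of other lengths only add pairs to a countable index set.\<close>
  define close where "close k r V \<longleftrightarrow> V \<in> Lin D \<and>
    (\<forall>j<k. \<bar>V (\<Phi> j) - of_rat (r ! j)\<bar> < 1 / real (Suc k))" for k :: nat and r :: "rat list" and V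
  define pick where "pick k r = (SOME V. close k r V)" for k r
  define C where "C = {pick k r |k r. \<exists>V. close k r V}"
  have pick: "close k r (pick k r)" if "close k r V" for k r V
    unfolding pick_def using that by (rule someI[of "close k r"])
  have "C \<subseteq> (\<lambda>(k, r). pick k r) ` UNIV" unfolding C_def by auto
  then have "countable C" by (rule countable_subset) simp
  moreover have C: "C \<subseteq> Lin D"
    using pick unfolding C_def close_def by blast
  moreover have "Lin D \<subseteq> mtopology closure_of C"
  proof
    fix U assume U: "U \<in> Lin D"
    have "\<exists>r. close k r U" for k
    proof -
      have "\<exists>s. \<bar>U (\<Phi> j) - of_rat s\<bar> < 1 / real (Suc k)" for j
      proof -
        have "U (\<Phi> j) - 1 / real (Suc k) < U (\<Phi> j) + 1 / real (Suc k)"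
          using divide_pos_pos[of 1 "real (Suc k)"] by linarith
        from of_rat_dense[OF this] obtain s where "U (\<Phi> j) - 1 / real (Suc k) < of_rat s"
          "of_rat s < U (\<Phi> j) + 1 / real (Suc k)" by blast
        then have "\<bar>U (\<Phi> j) - of_rat s\<bar> < 1 / real (Suc k)" by linarith
        then show ?thesis ..
      qed
      then obtain s where "\<And>j. \<bar>U (\<Phi> j) - of_rat (s j)\<bar> < 1 / real (Suc k)" by metis
      then have "close k (map s [0..<k]) U" using U by (simp add: close_def)
      then show ?thesis ..
    qed
    then obtain r where r: "\<And>k. close k (r k) U" by metis
    define V where "V k = pick k (r k)" for k
    have V: "close k (r k) (V k)" for k unfolding V_def using r by (rule pick)
    have VC: "V k \<in> C" for k unfolding V_def C_def using r by blast
    have "(\<lambda>k. V k (\<Phi> j)) \<longlonglongrightarrow> U (\<Phi> j)" for j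
    proof -
      \<comment> \<open>For \<open>k > j\<close> the coordinate \<open>j\<close> is among those
        constrained, and \<open>V k\<close> and \<open>U\<close> lie within \<open>1 / Suc k\<close>
        of the same rational; hence the factor 2.\<close>
      have "eventually (\<lambda>k. norm (V k (\<Phi> j) - U (\<Phi> j)) \<le> 2 * inverse (real (Suc k))) sequentially"
        using eventually_gt_at_top[of j]
      proof eventually_elim
        case (elim k)
        then have "\<bar>V k (\<Phi> j) - of_rat (r k ! j)\<bar> < 1 / real (Suc k)"
          "\<bar>U (\<Phi> j) - of_rat (r k ! j)\<bar> < 1 / real (Suc k)"
          using V[of k] r[of k] by (auto simp: close_def)
        then show ?case unfolding real_norm_def inverse_eq_divide by linarith
      qed
      moreover have "(\<lambda>k. 2 * inverse (real (Suc k))) \<longlonglongrightarrow> 0"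
        using tendsto_mult[OF tendsto_const LIMSEQ_inverse_real_of_nat, of 2] by simp
      ultimately have "(\<lambda>k. V k (\<Phi> j) - U (\<Phi> j)) \<longlonglongrightarrow> 0"
        by (rule Lim_null_comparison)
      then show ?thesis by (simp add: LIM_zero_iff)
    qed
    then have lim: "(\<lambda>k. dLin \<Phi> (V k) U) \<longlonglongrightarrow> 0"
      by (simp add: dLin_tendsto_0_iff)
    have "\<exists>W\<in>C. W \<in> mball U r" if "r > 0" for r
    proof -
      obtain k where "dLin \<Phi> (V k) U < r"
        using order_tendstoD(2)[OF lim \<open>r > 0\<close>] by (auto simp: eventually_sequentially)
      then show ?thesis
        using U VC C commute[of U "V k"] by (auto intro!: bexI[of _ "V k"])
    qed
    then show "U \<in> mtopology closure_of C"
      using U by (simp add: metric_closure_of)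
  qed
  moreover have "mtopology closure_of C \<subseteq> Lin D"
    using closure_of_subset_topspace[of mtopology C] by simp
  ultimately show ?thesis
    unfolding separable_space_def topspace_mtopology by blast
qed

section \<open>Boundedness, measurability and integrability of pairings\<close>

lemma span_over_bounded_measurable:
  assumes "\<And>a. a \<in> A \<Longrightarrow> a \<in> borel_measurable N" "\<And>a. a \<in> A \<Longrightarrow> \<exists>B. \<forall>z. \<bar>a z\<bar> \<le> B"
    and "\<phi> \<in> span_over K A"
  shows "\<phi> \<in> borel_measurable N" "\<exists>B. \<forall>z. \<bar>\<phi> z\<bar> \<le> B"
proof -
  obtain S c where S: "finite S" "S \<subseteq> A" "\<phi> = (\<lambda>z. \<Sum>a\<in>S. c a * a z)"
    using assms(3) unfolding span_over_def by blast
  show "\<phi> \<in> borel_measurable N"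
    unfolding S(3) using S(2) assms(1) by (intro borel_measurable_sum borel_measurable_times) auto
  have "\<forall>a\<in>S. \<exists>B. \<forall>z. \<bar>a z\<bar> \<le> B"
    using S(2) assms(2) by blast
  then obtain B where B: "\<And>a z. a \<in> S \<Longrightarrow> \<bar>a z\<bar> \<le> B a"
    using bchoice[of S "\<lambda>a b. \<forall>z. \<bar>a z\<bar> \<le> b"] by blast
  have "\<bar>\<phi> z\<bar> \<le> (\<Sum>a\<in>S. \<bar>c a\<bar> * B a)" for z
    unfolding S(3) using B
    by (intro order_trans[OF sum_abs] sum_mono) (simp add: abs_mult mult_left_mono)
  then show "\<exists>B. \<forall>z. \<bar>\<phi> z\<bar> \<le> B" by blast
qed

lemma Lin_restrictI:
  assumes "D = span_over UNIV A"
    and "\<And>\<phi> \<psi>. \<phi> \<in> D \<Longrightarrow> \<psi> \<in> D \<Longrightarrow> I (\<lambda>z. \<phi> z + \<psi> z) = I \<phi> + I \<psi>"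
    and "\<And>c \<phi>. \<phi> \<in> D \<Longrightarrow> I (\<lambda>z. c * \<phi> z) = c * I \<phi>"
  shows "restrict I D \<in> Lin D"
  using assms span_over_add[of UNIV _ A] span_over_scale[of UNIV _ _ A]
  unfolding Lin_def by auto

text \<open>The product is dominated by \<open>B * u\<close>. Pairings with test functions are
  handled through boundedness of the test function.\<close>

lemma integrable_mult_bounded:
  fixes u g :: "'a \<Rightarrow> real"
  assumes "integrable N u" "g \<in> borel_measurable N" "\<And>x. \<bar>g x\<bar> \<le> B"
  shows "integrable N (\<lambda>x. u x * g x)"
proof (rule Bochner_Integration.integrable_bound)
  show "integrable N (\<lambda>x. B * u x)" using assms(1) by simp
  show "AE x in N. norm (u x * g x) \<le> norm (B * u x)"
  proof (intro AE_I2)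
    fix x
    have "\<bar>u x\<bar> * \<bar>g x\<bar> \<le> \<bar>u x\<bar> * \<bar>B\<bar>"
      using assms(3)[of x] by (intro mult_left_mono) auto
    then show "norm (u x * g x) \<le> norm (B * u x)" by (simp add: abs_mult mult.commute)
  qed
qed (use assms in measurable)

text \<open>Pointwise \<open>\<bar>u\<bar> \<le> 1 + \<bar>u\<bar> powr r\<close>: trivial where
  \<open>\<bar>u\<bar> \<le> 1\<close>, and by monotonicity in the exponent elsewhere. The constant
  1 is integrable because the measure is finite.\<close>

lemma (in finite_measure) integrable_if_Lspace:
  assumes "u \<in> Lspace M r" "1 \<le> r"
  shows "integrable M u"
proof (rule Bochner_Integration.integrable_bound)
  show "integrable M (\<lambda>x. 1 + \<bar>u x\<bar> powr r)"
    using assms(1) by (simp add: Lspace_def)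
  show "AE x in M. norm (u x) \<le> norm (1 + \<bar>u x\<bar> powr r)"
  proof (intro AE_I2)
    fix x
    show "norm (u x) \<le> norm (1 + \<bar>u x\<bar> powr r)"
    proof (cases "\<bar>u x\<bar> \<le> 1")
      case False
      then have "\<bar>u x\<bar> powr 1 \<le> \<bar>u x\<bar> powr r" using assms(2) by (intro powr_mono) auto
      then show ?thesis using False by simp
    qed (simp add: add_increasing2)
  qed
qed (use assms in \<open>simp add: Lspace_def\<close>)

section \<open>Test functions and the maps \<open>J_eps\<close> and \<open>J_zero\<close> in the
  stochastic setting\<close>

context two_scale_setting
begin

lemma finite_measure_Q: "finite_measure (lebesgue_on Q)"
  using Q_bounded Q_open by (intro finite_measure_lebesgue_on bounded_set_imp_lmeasurable) auto

lemma pair_sigma_finite_Q: "pair_sigma_finite M (lebesgue_on Q)"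
proof -
  interpret finite_measure "lebesgue_on Q" by (rule finite_measure_Q)
  show ?thesis ..
qed

lemma finite_measure_prodM: "finite_measure (prodM M Q)"
  unfolding prodM_def by (intro finite_measure_pair_measure finite_measure_Q finite_measure_axioms)

lemma q_pos: "0 < q"
  using p_gt_1 by (simp add: q_def)

lemma testA_measurable:
  assumes "\<phi> \<in> testA (space M) Q D\<Omega> DQ"
  shows "\<phi> \<in> borel_measurable (prodM M Q)"
proof -
  obtain f g where fg: "f \<in> D\<Omega>" "g \<in> DQ" "\<phi> = tensor (space M) Q f g"
    using assms by (auto simp: testA_def)
  have [measurable]: "f \<in> borel_measurable M" using DOmega_measurable fg by auto
  have [measurable]: "g \<in> borel_measurable (lebesgue_on Q)"
    using DQ_dense fg by (auto simp: dense_in_L1_def Lspace_def)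
  have "(\<lambda>z. f (fst z) * g (snd z)) \<in> borel_measurable (M \<Otimes>\<^sub>M lebesgue_on Q)" by measurable
  then show ?thesis
    unfolding prodM_def fg(3)
    \<comment> \<open>On the space of the product measure the case distinction in
      \<open>tensor\<close> always takes its first branch.\<close>
    by (subst measurable_cong[where g = "\<lambda>z. f (fst z) * g (snd z)"])
       (auto simp: tensor_def space_pair_measure)
qed

text \<open>The factor on \<open>Q\<close> is continuous on the compact closure, the other factor is
  bounded by assumption, and extension by zero makes the bound valid on the whole type.\<close>

lemma testA_bounded:
  assumes "\<phi> \<in> testA (space M) Q D\<Omega> DQ"
  shows "\<exists>B. \<forall>z. \<bar>\<phi> z\<bar> \<le> B"
proof -
  obtain f g where fg: "f \<in> D\<Omega>" "g \<in> DQ" "\<phi> = tensor (space M) Q f g"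
    using assms by (auto simp: testA_def)
  obtain B where B: "\<forall>\<omega>\<in>space M. \<bar>f \<omega>\<bar> \<le> B" using DOmega_bounded fg by blast
  have "bounded (g ` closure Q)"
    using Q_bounded DQ_continuous[OF fg(2)]
    by (intro compact_imp_bounded compact_continuous_image) (auto simp: compact_closure)
  then obtain C where "\<forall>x\<in>closure Q. \<bar>g x\<bar> \<le> C" by (auto simp: bounded_iff)
  then have C: "\<bar>g x\<bar> \<le> C" if "x \<in> Q" for x using that closure_subset by blast
  have "\<bar>tensor (space M) Q f g (\<omega>, x)\<bar> \<le> \<bar>B\<bar> * \<bar>C\<bar>" for \<omega> x
  proof (cases "\<omega> \<in> space M \<and> x \<in> Q")
    case True
    then have "\<bar>f \<omega>\<bar> \<le> \<bar>B\<bar>" "\<bar>g x\<bar> \<le> \<bar>C\<bar>" using B C by force+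
    then have "\<bar>f \<omega>\<bar> * \<bar>g x\<bar> \<le> \<bar>B\<bar> * \<bar>C\<bar>" by (intro mult_mono) auto
    then show ?thesis using True by (simp add: tensor_def abs_mult)
  qed (auto simp: tensor_def)
  then show ?thesis using fg(3) by (metis surj_pair)
qed

text \<open>\<open>K\<close> stays free so that rational and real combinations are both
  covered.\<close>

lemma span_testA_measurable:
  "\<phi> \<in> span_over K (testA (space M) Q D\<Omega> DQ) \<Longrightarrow> \<phi> \<in> borel_measurable (prodM M Q)"
  by (rule span_over_bounded_measurable(1)[where A = "testA (space M) Q D\<Omega> DQ"])
     (erule testA_measurable testA_bounded | assumption)+

lemma span_testA_bounded:
  "\<phi> \<in> span_over K (testA (space M) Q D\<Omega> DQ) \<Longrightarrow> \<exists>B. \<forall>z. \<bar>\<phi> z\<bar> \<le> B"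
  by (rule span_over_bounded_measurable(2)[where A = "testA (space M) Q D\<Omega> DQ"])
     (erule testA_measurable testA_bounded | assumption)+

lemma unfolding_op_measurable:
  assumes "\<omega> \<in> space M" "\<phi> \<in> borel_measurable (prodM M Q)"
  shows "unfolding_op \<tau> \<epsilon> \<phi> \<omega> \<in> borel_measurable (lebesgue_on Q)"
proof -
  have "(\<lambda>x. (\<omega>, x)) \<in> lebesgue \<rightarrow>\<^sub>M M \<Otimes>\<^sub>M lebesgue" using assms(1) by simp
  from measurable_compose[OF this tau_jointly_measurable]
  have "(\<lambda>x. \<tau> x \<omega>) \<in> lebesgue \<rightarrow>\<^sub>M M" by simp
  \<comment> \<open>The section of \<open>\<tau>\<close> at \<open>\<omega>\<close> is measurable
    only for the Lebesgue sigma-algebra, so the dilation must be measurable from Lebesgue to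
    Lebesgue sets, not merely Borel.\<close>
  from measurable_compose[OF lebesgue_measurable_scaling[of "inverse \<epsilon>"] this]
  have [measurable]: "(\<lambda>x. \<tau> (x /\<^sub>R \<epsilon>) \<omega>) \<in> lebesgue_on Q \<rightarrow>\<^sub>M M"
    by (rule measurable_restrict_space1)
  have "(\<lambda>x. (\<tau> (x /\<^sub>R \<epsilon>) \<omega>, x)) \<in> lebesgue_on Q \<rightarrow>\<^sub>M prodM M Q"
    unfolding prodM_def by measurable
  from measurable_compose[OF this assms(2)] show ?thesis
    unfolding unfolding_op_def .
qed

lemma J_eps_in_Lin:
  assumes D: "D = testD (space M) Q D\<Omega> DQ" and \<omega>: "\<omega> \<in> space M"
    and u: "u \<in> Lspace (lebesgue_on Q) p"
  shows "J_eps \<tau> Q D \<epsilon> \<omega> u \<in> Lin D"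
  unfolding J_eps_def
proof (rule Lin_restrictI[OF D[unfolded testD_def]])
  interpret Q: finite_measure "lebesgue_on Q" by (rule finite_measure_Q)
  \<comment> \<open>Integrability is what makes the integral additive in the test function.\<close>
  have int: "integrable (lebesgue_on Q) (\<lambda>x. u x * unfolding_op \<tau> \<epsilon> \<phi> \<omega> x)" if \<phi>: "\<phi> \<in> D" for \<phi>
  proof -
    obtain B where B: "\<And>z. \<bar>\<phi> z\<bar> \<le> B"
      using span_testA_bounded \<phi> D unfolding testD_def by blast
    have "\<phi> \<in> borel_measurable (prodM M Q)"
      using span_testA_measurable \<phi> D unfolding testD_def by blast
    then show ?thesis
      using u p_gt_1 B \<omega>
      by (intro integrable_mult_bounded[where B = B] Q.integrable_if_Lspace[where r = p]
          unfolding_op_measurable) (auto simp: unfolding_op_def)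
  qed
  fix \<phi> assume \<phi>: "\<phi> \<in> D"
  show "(\<integral>x. u x * unfolding_op \<tau> \<epsilon> (\<lambda>z. c * \<phi> z) \<omega> x \<partial>lebesgue_on Q) =
      c * (\<integral>x. u x * unfolding_op \<tau> \<epsilon> \<phi> \<omega> x \<partial>lebesgue_on Q)" for c
    by (simp add: unfolding_op_def mult.left_commute)
  fix \<psi> assume \<psi>: "\<psi> \<in> D"
  have "(\<integral>x. u x * unfolding_op \<tau> \<epsilon> (\<lambda>z. \<phi> z + \<psi> z) \<omega> x \<partial>lebesgue_on Q) =
      (\<integral>x. u x * unfolding_op \<tau> \<epsilon> \<phi> \<omega> x + u x * unfolding_op \<tau> \<epsilon> \<psi> \<omega> x \<partial>lebesgue_on Q)"
    by (simp add: unfolding_op_def distrib_left)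
  then show "(\<integral>x. u x * unfolding_op \<tau> \<epsilon> (\<lambda>z. \<phi> z + \<psi> z) \<omega> x \<partial>lebesgue_on Q) =
      (\<integral>x. u x * unfolding_op \<tau> \<epsilon> \<phi> \<omega> x \<partial>lebesgue_on Q) +
      (\<integral>x. u x * unfolding_op \<tau> \<epsilon> \<psi> \<omega> x \<partial>lebesgue_on Q)"
    using int \<phi> \<psi> by simp
qed

lemma J_zero_in_Lin:
  assumes D: "D = testD (space M) Q D\<Omega> DQ" and u: "u \<in> Lspace (prodM M Q) p"
  shows "J_zero M Q D u \<in> Lin D"
proof -
  interpret Q: pair_sigma_finite M "lebesgue_on Q" by (rule pair_sigma_finite_Q)
  interpret prod: finite_measure "prodM M Q" by (rule finite_measure_prodM)
  have int: "integrable (prodM M Q) (\<lambda>z. u z * \<phi> z)" if \<phi>: "\<phi> \<in> D" for \<phi>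
  proof -
    obtain B where B: "\<And>z. \<bar>\<phi> z\<bar> \<le> B"
      using span_testA_bounded \<phi> D unfolding testD_def by blast
    have "\<phi> \<in> borel_measurable (prodM M Q)"
      using span_testA_measurable \<phi> D unfolding testD_def by blast
    then show ?thesis
      using u p_gt_1 B
      by (intro integrable_mult_bounded[where B = B] prod.integrable_if_Lspace[where r = p]) auto
  qed
  \<comment> \<open>Fubini replaces the iterated integral by one over the product, where linearity
    follows from \<open>int\<close> directly.\<close>
  have "(\<integral>\<omega>. (\<integral>x. u (\<omega>, x) * \<phi> (\<omega>, x) \<partial>lebesgue_on Q) \<partial>M) = (\<integral>z. u z * \<phi> z \<partial>prodM M Q)"
    if "\<phi> \<in> D" for \<phi>
    using Q.integral_fst'[OF int[OF that, unfolded prodM_def]] by (simp add: prodM_def)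
  then have "J_zero M Q D u = (\<lambda>\<phi>\<in>D. \<integral>z. u z * \<phi> z \<partial>prodM M Q)"
    unfolding J_zero_def by (intro restrict_ext)
  also have "\<dots> \<in> Lin D"
    by (rule Lin_restrictI[OF D[unfolded testD_def]])
       (auto simp: distrib_left mult.left_commute int)
  finally show ?thesis .
qed

text \<open>A test function of norm zero need not vanish identically, and then no \<open>\<Phi> j\<close> is a multiple
  of it; it is nevertheless the difference of two test functions of nonzero norm.\<close>

lemma testD_eq_span_range:
  fixes \<Phi> :: "nat \<Rightarrow> 'w \<times> (real^'n) \<Rightarrow> real"
  assumes enum: "range \<Phi> = {(\<lambda>z. \<phi> z / Lnorm (prodM M Q) q \<phi>) |\<phi>.
    \<phi> \<in> testD0 (space M) Q D\<Omega> DQ \<and> Lnorm (prodM M Q) q \<phi> \<noteq> 0}"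
  shows "testD (space M) Q D\<Omega> DQ = span_over UNIV (range \<Phi>)"
proof
  interpret prod: finite_measure "prodM M Q" by (rule finite_measure_prodM)
  let ?A = "testA (space M) Q D\<Omega> DQ" and ?N = "Lnorm (prodM M Q) q"
  have normalized: "\<phi> \<in> span_over UNIV (range \<Phi>)" if \<phi>: "\<phi> \<in> span_over \<rat> ?A" "?N \<phi> \<noteq> 0" for \<phi>
  proof -
    have "(\<lambda>z. \<phi> z / ?N \<phi>) \<in> range \<Phi>"
      unfolding enum testD0_def using \<phi> by blast
    then have "(\<lambda>z. ?N \<phi> * (\<phi> z / ?N \<phi>)) \<in> span_over UNIV (range \<Phi>)"
      by (intro span_over_scale span_over_base) auto
    then show ?thesis using \<phi>(2) by simp
  qed
  have "?A \<subseteq> span_over UNIV (range \<Phi>)"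
  proof
    fix a assume a: "a \<in> ?A"
    have aD0: "a \<in> span_over \<rat> ?A" using a by (intro span_over_base) auto
    show "a \<in> span_over UNIV (range \<Phi>)"
    proof (cases "?N a = 0")
      case True
      obtain B where B: "\<And>z. \<bar>a z\<bar> \<le> B" using testA_bounded[OF a] by blast
      have [measurable]: "a \<in> borel_measurable (prodM M Q)" using a by (rule testA_measurable)
      \<comment> \<open>This excludes that the integral vanishes only as the default value for a
        non-integrable function.\<close>
      have "integrable (prodM M Q) (\<lambda>z. \<bar>a z\<bar> powr q)"
        using B q_pos by (intro prod.integrable_const_bound[where B = "B powr q"])
          (auto intro!: AE_I2 powr_mono2)
      moreover have "(\<integral>z. \<bar>a z\<bar> powr q \<partial>prodM M Q) = 0"
        using True by (simp add: Lnorm_def)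
      ultimately have "AE z in prodM M Q. \<bar>a z\<bar> powr q = 0"
        by (subst (asm) integral_nonneg_eq_0_iff_AE) auto
      then have a0: "AE z in prodM M Q. a z = 0" by simp
      \<comment> \<open>The range of \<open>\<Phi>\<close> is nonempty, so \<open>enum\<close>
        itself supplies a function of nonzero norm.\<close>
      have "\<Phi> 0 \<in> range \<Phi>" by simp
      then obtain \<phi> where \<phi>: "\<phi> \<in> span_over \<rat> ?A" "?N \<phi> \<noteq> 0"
        unfolding enum testD0_def by blast
      have [measurable]: "\<phi> \<in> borel_measurable (prodM M Q)"
        using \<phi>(1) by (rule span_testA_measurable)
      \<comment> \<open>Adding \<open>a\<close> alters \<open>\<phi>\<close> only on a null set, so
        the sum keeps its nonzero norm and its normalization is again enumerated.\<close>
      have "(\<integral>z. \<bar>\<phi> z + a z\<bar> powr q \<partial>prodM M Q) = (\<integral>z. \<bar>\<phi> z\<bar> powr q \<partial>prodM M Q)"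
        using a0 by (intro integral_cong_AE) auto
      then have "?N (\<lambda>z. \<phi> z + a z) \<noteq> 0"
        using \<phi>(2) by (simp add: Lnorm_def)
      then have "(\<lambda>z. \<phi> z + a z) \<in> span_over UNIV (range \<Phi>)"
        using \<phi>(1) aD0 by (intro normalized span_over_add) auto
      moreover have "(\<lambda>z. - 1 * \<phi> z) \<in> span_over UNIV (range \<Phi>)"
        using normalized[OF \<phi>] by (intro span_over_scale) auto
      ultimately have "(\<lambda>z. (\<phi> z + a z) + - 1 * \<phi> z) \<in> span_over UNIV (range \<Phi>)"
        by (rule span_over_add[OF UNIV_I UNIV_I])
      then show ?thesis by simp
    qed (use aD0 normalized in blast)
  qed
  then show "testD (space M) Q D\<Omega> DQ \<subseteq> span_over UNIV (range \<Phi>)"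
    unfolding testD_def by (rule span_over_minimal)
  have "range \<Phi> \<subseteq> span_over UNIV ?A"
  proof
    fix f assume "f \<in> range \<Phi>"
    then obtain \<phi> where \<phi>: "\<phi> \<in> span_over \<rat> ?A" "f = (\<lambda>z. \<phi> z / ?N \<phi>)"
      unfolding enum testD0_def by blast
    then have "\<phi> \<in> span_over UNIV ?A" using span_over_mono[of \<rat> UNIV] by blast
    then have "(\<lambda>z. inverse (?N \<phi>) * \<phi> z) \<in> span_over UNIV ?A" by (intro span_over_scale) auto
    then show "f \<in> span_over UNIV ?A" by (simp add: \<phi>(2) divide_inverse mult.commute)
  qed
  then show "span_over UNIV (range \<Phi>) \<subseteq> testD (space M) Q D\<Omega> DQ"
    unfolding testD_def by (rule span_over_minimal)
qed

end

section \<open>Two-scale convergence as convergence in the metric space of functionals\<close>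

theorem lemma3p8:
  fixes M :: "'w measure" and \<tau> :: "real^'n \<Rightarrow> 'w \<Rightarrow> 'w"
    and p q :: real and Q :: "(real^'n) set"
    and D\<Omega> :: "('w \<Rightarrow> real) set" and DQ :: "(real^'n \<Rightarrow> real) set" and \<Omega>0 :: "'w set"
    and \<D> \<D>0 :: "('w \<times> (real^'n) \<Rightarrow> real) set"
    and \<Phi> :: "nat \<Rightarrow> 'w \<times> (real^'n) \<Rightarrow> real"
  assumes setting: "two_scale_setting M \<tau> p q Q D\<Omega> DQ \<Omega>0"
    and D_def: "\<D> = testD (space M) Q D\<Omega> DQ"
    and D0_def: "\<D>0 = testD0 (space M) Q D\<Omega> DQ"
    and enum: "range \<Phi> = {(\<lambda>z. \<phi> z / Lnorm (prodM M Q) q \<phi>) |\<phi>.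
                  \<phi> \<in> \<D>0 \<and> Lnorm (prodM M Q) q \<phi> \<noteq> 0}"
  shows "((\<lambda>\<phi>\<in>\<D>. 0) \<in> Lin \<D> \<and>
          (\<forall>U \<in> Lin \<D>. \<forall>V \<in> Lin \<D>. \<forall>a b. (\<lambda>\<phi>\<in>\<D>. a * U \<phi> + b * V \<phi>) \<in> Lin \<D>) \<and>
          Metric_space (Lin \<D>) (dLin \<Phi>) \<and>
          Metric_space.mcomplete (Lin \<D>) (dLin \<Phi>) \<and>
          separable_space (Metric_space.mtopology (Lin \<D>) (dLin \<Phi>))) \<and>
         (\<forall>\<omega>0 \<in> \<Omega>0.
          (\<forall>\<epsilon> > 0. J_eps \<tau> Q \<D> \<epsilon> \<omega>0 \<in> Lspace (lebesgue_on Q) p \<rightarrow> Lin \<D>) \<and>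
          J_zero M Q \<D> \<in> Lspace (prodM M Q) p \<rightarrow> Lin \<D> \<and>
          (\<forall>u u0. bounded_seq_Lp Q p u \<and> u0 \<in> Lspace (prodM M Q) p \<longrightarrow>
            (quenched_two_scale M \<tau> Q p \<D> \<omega>0 u u0 \<longleftrightarrow>
             limitin (Metric_space.mtopology (Lin \<D>) (dLin \<Phi>))
               (\<lambda>\<epsilon>. J_eps \<tau> Q \<D> \<epsilon> \<omega>0 (u \<epsilon>)) (J_zero M Q \<D> u0) (at_right 0))))"
proof -
  interpret two_scale_setting M \<tau> p q Q D\<Omega> DQ \<Omega>0 by (rule setting)
  have D: "\<D> = span_over UNIV (range \<Phi>)"
    using testD_eq_span_range enum unfolding D_def D0_def .
  have zero: "(\<lambda>\<phi>\<in>\<D>. 0) \<in> Lin \<D>"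
    by (rule Lin_restrictI[OF D]) simp_all
  have "quenched_two_scale M \<tau> Q p \<D> \<omega>0 u u0 \<longleftrightarrow>
      limitin (Metric_space.mtopology (Lin \<D>) (dLin \<Phi>))
        (\<lambda>\<epsilon>. J_eps \<tau> Q \<D> \<epsilon> \<omega>0 (u \<epsilon>)) (J_zero M Q \<D> u0) (at_right 0)"
    if "\<omega>0 \<in> space M" "bounded_seq_Lp Q p u" "u0 \<in> Lspace (prodM M Q) p" for \<omega>0 u u0
  proof (subst limitin_Lin_iff[OF D])
    show "J_zero M Q \<D> u0 \<in> Lin \<D>" using D_def that(3) by (rule J_zero_in_Lin)
    show "eventually (\<lambda>\<epsilon>. J_eps \<tau> Q \<D> \<epsilon> \<omega>0 (u \<epsilon>) \<in> Lin \<D>) (at_right 0)"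
      using eventually_at_right_less[of 0]
    proof eventually_elim
      case (elim \<epsilon>)
      then show ?case using that(1,2) by (intro J_eps_in_Lin[OF D_def]) (auto simp: bounded_seq_Lp_def)
    qed
    \<comment> \<open>The boundedness clause of two-scale convergence is already assumed, so only
      the limits of the pairings remain to be compared.\<close>
    show "quenched_two_scale M \<tau> Q p \<D> \<omega>0 u u0 \<longleftrightarrow>
      (\<forall>\<phi>\<in>\<D>. ((\<lambda>\<epsilon>. J_eps \<tau> Q \<D> \<epsilon> \<omega>0 (u \<epsilon>) \<phi>) \<longlongrightarrow> J_zero M Q \<D> u0 \<phi>) (at_right 0))"
      using that(2) by (simp add: quenched_two_scale_def J_eps_def J_zero_def)
  qed
  moreover have "\<Omega>0 \<subseteq> space M" using Omega0_sets by (rule sets.sets_into_space)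
  ultimately show ?thesis
    using zero Lin_combination[OF D] Metric_space_Lin[OF D] mcomplete_Lin[OF D] separable_Lin[OF D]
      J_eps_in_Lin[OF D_def] J_zero_in_Lin[OF D_def]
    by (intro conjI ballI allI impI Pi_I) (auto simp del: restrict_apply)
qed

end
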